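(* Let $H$ be a hypergraph with a minimal edge cut $F=\{f_1,f_2\}$ of cardinality $2$. Let $H_i$, for $i\in I$ (with $1,2\in I$), denote the connected components of $H\setminus F$. Further, assume that $H_1$ and $H_2$ are non-empty (each has at least one edge) and that $H_i$ is empty (edgeless) for all $i\in I\setminus\{1,2\}$. For each $i\in\{1,2\}$, let $H_i^*$ be the collapsed hypergraph $H\circ\big(\bigcup_{j\in I, j\neq i}V(H_j)\big)$. Then $H$ has an Euler tour $T$ if and only if each $H_i^*$, for $i=1,2$, has an Euler tour $T_i$ that traverses the collapsed vertex of $H_i^*$. Furthermore, $T$ is spanning in $H$ if and only if $|I|=2$ and $T_i$, for $i=1,2$, is spanning in $H_i^*$.
   Context: A hypergraph $H=(V,E)$ has a non-empty finite vertex set $V$ and a finite collection $E$ of edges, each associated with a subset of $V$; parallel edges are allowed, so $E$ is a multiset of subsets of $V$. A walk is a sequence $v_0e_1v_1\dots v_{r-1}e_rv_r$ ($r\ge 0$) with $v_{i-1}\ne v_i$ and $v_{i-1},v_i\in e_i$ for all $i=1,\dots,r$; its anchors (the vertices it traverses) are $v_0,\dots,v_r$; it is closed if $v_0=v_r$, and a strict trail if its edges are pairwise distinct. $H$ is connected if any two vertices are joined by a walk; the connected components of $H$ are its maximal connected subhypergraphs $(V',E')$ with $V'\subseteq V$, $E'\subseteq E$, having no empty edges. An Euler tour of $H$ is a closed strict trail traversing every edge of $H$ exactly once; it is spanning if every vertex of $H$ is an anchor of it. For $\emptyset\neq S\subsetneq V$, the set $[S,\overline S]=\{e\in E: e\cap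 S\neq\emptyset,\ e\cap\overline S\neq\emptyset\}$, with $\overline S=V\setminus S$, is an edge cut of $H$; an edge cut is minimal if it properly contains no edge cut of $H$. $H\setminus F=(V,E\setminus F)$. Collapsed hypergraph: for $V_1\subseteq V$ and $V_0=V\setminus V_1$, the hypergraph $H\circ V_1$ has vertex set $V_0\cup\{v_1\}$, where $v_1\notin V$ is a new vertex (the collapsed vertex); its edges are obtained by replacing each $e\in E$ by $(e\cap V_0)\cup\{v_1\}$ if $e\cap V_1\neq\emptyset$ and by $e$ otherwise (one for each $e\in E$, keeping multiplicities), and then discarding those of cardinality less than $2$.
   Formalization: Every edge of H is assumed to have at least 2 vertices (a singleton or empty edge is discarded in forming H_i^* but blocks any Euler tour of H, so the "if" part fails); in the last sentence T and T_1, T_2 are read as corresponding tours. *)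

theory Defs
  imports Main
begin

(* Edges are labels, and ends maps a label to its vertex subset, so that parallel
   edges are distinct labels with equal ends.  The value of ends outside the edge set
   is irrelevant. *)
record ('v, 'e) pre_hypergraph =
  verts :: "'v set"
  edges :: "'e set"
  ends :: "'e \<Rightarrow> 'v set"

locale hypergraph =
  fixes H :: "('v, 'e) pre_hypergraph"
  assumes verts_nonempty: "verts H \<noteq> {}"
    and finite_verts: "finite (verts H)"
    and finite_edges: "finite (edges H)"
    and ends_subset: "e \<in> edges H \<Longrightarrow> ends H e \<subseteq> verts H"

(* v_0 e_1 v_1 ... e_r v_r is the pair ([v_0, ..., v_r], [e_1, ..., e_r]). *)
type_synonym ('v, 'e) walk = "'v list \<times> 'e list"

definition anchors :: "('v, 'e) walk \<Rightarrow> 'v set" where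
  "anchors W = set (fst W)"

definition is_walk :: "('v, 'e) pre_hypergraph \<Rightarrow> ('v, 'e) walk \<Rightarrow> bool" where
  "is_walk H W \<longleftrightarrow> (case W of (vs, es) \<Rightarrow>
     length vs = Suc (length es) \<and> set vs \<subseteq> verts H \<and> set es \<subseteq> edges H \<and>
     (\<forall>i < length es. vs ! i \<noteq> vs ! Suc i \<and>
        vs ! i \<in> ends H (es ! i) \<and> vs ! Suc i \<in> ends H (es ! i)))"

definition closed_walk :: "('v, 'e) walk \<Rightarrow> bool" where
  "closed_walk W \<longleftrightarrow> hd (fst W) = last (fst W)"

definition strict_trail :: "('v, 'e) pre_hypergraph \<Rightarrow> ('v, 'e) walk \<Rightarrow> bool" where
  "strict_trail H W \<longleftrightarrow> is_walk H W \<and> distinct (snd W)"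

definition euler_tour :: "('v, 'e) pre_hypergraph \<Rightarrow> ('v, 'e) walk \<Rightarrow> bool" where
  "euler_tour H T \<longleftrightarrow> strict_trail H T \<and> closed_walk T \<and> set (snd T) = edges H"

definition spanning :: "('v, 'e) pre_hypergraph \<Rightarrow> ('v, 'e) walk \<Rightarrow> bool" where
  "spanning H T \<longleftrightarrow> verts H \<subseteq> anchors T"

definition connected_hg :: "('v, 'e) pre_hypergraph \<Rightarrow> bool" where
  "connected_hg H \<longleftrightarrow> (\<forall>u \<in> verts H. \<forall>v \<in> verts H.
     \<exists>W. is_walk H W \<and> hd (fst W) = u \<and> last (fst W) = v)"

(* ends is required to agree everywhere, so that a subhypergraph is determined
   by its vertex set and its edge set. *)
definition subhypergraph ::
    "('v, 'e) pre_hypergraph \<Rightarrow> ('v, 'e) pre_hypergraph \<Rightarrow> bool" where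
  "subhypergraph K H \<longleftrightarrow> hypergraph K \<and>
     verts K \<subseteq> verts H \<and> edges K \<subseteq> edges H \<and> ends K = ends H"

definition connected_sub ::
    "('v, 'e) pre_hypergraph \<Rightarrow> ('v, 'e) pre_hypergraph \<Rightarrow> bool" where
  "connected_sub H K \<longleftrightarrow> subhypergraph K H \<and> connected_hg K \<and>
     (\<forall>e \<in> edges K. ends K e \<noteq> {})"

definition components :: "('v, 'e) pre_hypergraph \<Rightarrow> ('v, 'e) pre_hypergraph set" where
  "components H = {K. connected_sub H K \<and>
     (\<forall>L. connected_sub H L \<and> subhypergraph K L \<longrightarrow> L = K)}"

definition cut :: "('v, 'e) pre_hypergraph \<Rightarrow> 'v set \<Rightarrow> 'e set" where
  "cut H S = {e \<in> edges H. ends H e \<inter> S \<noteq> {} \<and> ends H e \<inter> (verts H - S) \<noteq> {}}"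

definition edge_cut :: "('v, 'e) pre_hypergraph \<Rightarrow> 'e set \<Rightarrow> bool" where
  "edge_cut H F \<longleftrightarrow> (\<exists>S. S \<noteq> {} \<and> S \<subset> verts H \<and> F = cut H S)"

definition minimal_edge_cut :: "('v, 'e) pre_hypergraph \<Rightarrow> 'e set \<Rightarrow> bool" where
  "minimal_edge_cut H F \<longleftrightarrow> edge_cut H F \<and> (\<forall>F'. F' \<subset> F \<longrightarrow> \<not> edge_cut H F')"

definition del_edges ::
    "('v, 'e) pre_hypergraph \<Rightarrow> 'e set \<Rightarrow> ('v, 'e) pre_hypergraph" where
  "del_edges H F = H\<lparr>edges := edges H - F\<rparr>"

(* The old vertices are embedded by Some; None is the new, collapsed vertex. *)
definition collapse_ends ::
    "('v, 'e) pre_hypergraph \<Rightarrow> 'v set \<Rightarrow> 'e \<Rightarrow> 'v option set" where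
  "collapse_ends H V1 e =
     (if ends H e \<inter> V1 \<noteq> {} then insert None (Some ` (ends H e \<inter> (verts H - V1)))
      else Some ` ends H e)"

definition collapse ::
    "('v, 'e) pre_hypergraph \<Rightarrow> 'v set \<Rightarrow> ('v option, 'e) pre_hypergraph" where
  "collapse H V1 =
     \<lparr>verts = insert None (Some ` (verts H - V1)),
      edges = {e \<in> edges H. \<not> card (collapse_ends H V1 e) < 2},
      ends = collapse_ends H V1\<rparr>"

(* H_i^* for the component K = H_i of H - F *)
definition collapse_others ::
    "('v, 'e) pre_hypergraph \<Rightarrow> 'e set \<Rightarrow> ('v, 'e) pre_hypergraph
      \<Rightarrow> ('v option, 'e) pre_hypergraph" where
  "collapse_others H F K = collapse H (\<Union>L \<in> components (del_edges H F) - {K}. verts L)"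

end

theory Submission
  imports Defs
begin

text \<open>
  Minimality of the cut forces both \<open>f1\<close> and \<open>f2\<close> to meet every component of \<open>H - {f1, f2}\<close>:
  the edges leaving a component form an edge cut contained in \<open>{f1, f2}\<close>, hence equal to it
  (\<open>cut_comp\<close>). The collapsed hypergraph of a component \<open>K\<close> therefore consists of \<open>K\<close>, the
  collapsed vertex \<open>None\<close>, and the two cut edges, each of which joins \<open>None\<close> to \<open>K\<close>; no other
  edge contains \<open>None\<close> (\<open>star_edges\<close>).

  The common currency of all the tours involved is an arc of a component \<open>K\<close>: a walk in \<open>K\<close>
  using every edge of \<open>K\<close> exactly once, starting at a vertex of \<open>f1\<close> and ending at a vertex of
  \<open>f2\<close>. Removing \<open>f1\<close> and \<open>f2\<close> from an Euler tour of any hypergraph leaves two walks that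
  together use all other edges, and conversely two such walks close up to an Euler tour
  (\<open>euler_tour_imp_two_arc_tour\<close>, \<open>two_arc_tour_imp_euler_tour\<close>). In the collapsed hypergraph
  of \<open>K\<close> the walk through \<open>None\<close> must be trivial, since \<open>None\<close> cannot be left without a cut
  edge; the other walk is an arc of \<open>K\<close>. In \<open>H\<close> each walk is trapped in one component, and
  since both \<open>H1\<close> and \<open>H2\<close> have edges, one walk is an arc of \<open>H1\<close> and the other, reversed, an
  arc of \<open>H2\<close>. So tours of \<open>H\<close> correspond to pairs of arcs, and tours of the collapsed
  hypergraphs through \<open>None\<close> to single arcs.

  These correspondences keep track of the anchors. A tour of \<open>H\<close> visits only vertices of
  \<open>H1\<close> and \<open>H2\<close>, so it is spanning exactly when there is no third component and each arc visits
  all of its component, that is, when both collapsed tours are spanning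
  (\<open>spanning_tour_iff\<close>).
\<close>

section \<open>Walks\<close>

definition joins :: "('v, 'e) pre_hypergraph \<Rightarrow> 'e \<Rightarrow> 'v \<Rightarrow> 'v \<Rightarrow> bool" where
  "joins G e u v \<longleftrightarrow> e \<in> edges G \<and> u \<noteq> v \<and> u \<in> ends G e \<and> v \<in> ends G e"

lemma joins_commute: "joins G e u v \<longleftrightarrow> joins G e v u"
  by (auto simp: joins_def)

lemma is_walk_nonempty: "is_walk G (vs, es) \<Longrightarrow> vs \<noteq> []"
  by (auto simp: is_walk_def)

lemma is_walk_length: "is_walk G (vs, es) \<Longrightarrow> length vs = Suc (length es)"
  by (simp add: is_walk_def)

lemma is_walk_verts: "is_walk G (vs, es) \<Longrightarrow> set vs \<subseteq> verts G"
  by (simp add: is_walk_def)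

lemma is_walk_edges: "is_walk G (vs, es) \<Longrightarrow> set es \<subseteq> edges G"
  by (simp add: is_walk_def)

lemma is_walk_Nil: "is_walk G (vs, []) \<longleftrightarrow> (\<exists>v \<in> verts G. vs = [v])"
  by (auto simp: is_walk_def length_Suc_conv)

lemma is_walk_Cons:
  "is_walk G (v # w # vs, e # es) \<longleftrightarrow> v \<in> verts G \<and> joins G e v w \<and> is_walk G (w # vs, es)"
  by (auto simp: is_walk_def joins_def All_less_Suc2)

lemma is_walk_ConsE:
  assumes "is_walk G (vs, e # es)"
  obtains v w ws where "vs = v # w # ws" "v \<in> verts G" "joins G e v w" "is_walk G (w # ws, es)"
proof -
  have "length vs = Suc (Suc (length es))"
    using is_walk_length[OF assms] by simp
  then obtain v w ws where "vs = v # w # ws"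
    by (auto simp: length_Suc_conv)
  with assms that show thesis
    by (auto simp: is_walk_Cons)
qed

lemma is_walk_append_iff:
  assumes "length vs = Suc (length es)"
  shows "is_walk G (vs @ ws, es @ e # fs) \<longleftrightarrow>
    is_walk G (vs, es) \<and> joins G e (last vs) (hd ws) \<and> is_walk G (ws, fs)"
  using assms
proof (induction es arbitrary: vs)
  case Nil
  then obtain v where vs: "vs = [v]"
    by (auto simp: length_Suc_conv)
  show ?case
  proof (cases ws)
    case Nil
    then show ?thesis
      by (auto simp: vs is_walk_def)
  next
    case (Cons w ws')
    then show ?thesis
      by (auto simp: vs is_walk_Cons is_walk_Nil)
  qed
next
  case (Cons f es)
  then obtain v w vs' where vs: "vs = v # w # vs'"
    by (auto simp: length_Suc_conv)
  have "is_walk G ((w # vs') @ ws, es @ e # fs) \<longleftrightarrow>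
      is_walk G (w # vs', es) \<and> joins G e (last (w # vs')) (hd ws) \<and> is_walk G (ws, fs)"
    by (rule Cons.IH) (use Cons.prems vs in simp)
  then show ?case
    by (simp add: vs is_walk_Cons conj_assoc)
qed

lemma is_walk_splitE:
  assumes "is_walk G (vs, es @ e # fs)"
  obtains us ws where "vs = us @ ws" "is_walk G (us, es)" "joins G e (last us) (hd ws)"
    "is_walk G (ws, fs)"
proof -
  let ?us = "take (Suc (length es)) vs" and ?ws = "drop (Suc (length es)) vs"
  have "length ?us = Suc (length es)"
    using is_walk_length[OF assms] by simp
  from is_walk_append_iff[OF this, of G ?ws e fs] assms that[of ?us ?ws] show thesis
    by simp
qed

lemma is_walk_glue:
  assumes "is_walk G (us, es)" "is_walk G (ws, fs)" "last us = hd ws"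
  shows "is_walk G (us @ tl ws, es @ fs)"
proof (cases fs)
  case Nil
  with assms show ?thesis
    by (auto simp: is_walk_Nil)
next
  case (Cons f fs')
  with assms(2) obtain v w ws' where ws: "ws = v # w # ws'"
    "joins G f v w" "is_walk G (w # ws', fs')"
    by (auto elim: is_walk_ConsE)
  with assms Cons show ?thesis
    by (simp add: is_walk_append_iff is_walk_length)
qed

lemma is_walk_rev: "is_walk G (vs, es) \<Longrightarrow> is_walk G (rev vs, rev es)"
proof (induction es arbitrary: vs)
  case Nil
  then show ?case
    by (auto simp: is_walk_Nil)
next
  case (Cons e es)
  then obtain v w ws where vs: "vs = v # w # ws" "v \<in> verts G" "joins G e v w"
    and walk: "is_walk G (w # ws, es)"
    by (auto elim: is_walk_ConsE)
  have "is_walk G (rev (w # ws) @ [v], rev es @ [e])"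
    using vs Cons.IH[OF walk] is_walk_length[OF walk]
    by (subst is_walk_append_iff) (auto simp: is_walk_Nil joins_commute)
  then show ?case
    by (simp add: vs)
qed

text \<open>This moves walks between \<open>H\<close>, its components and the collapsed hypergraphs. The edge labels
  stay the same and only the vertices change, by \<open>Some\<close> or \<open>the\<close>; injectivity keeps consecutive
  anchors distinct.\<close>

lemma is_walk_map:
  assumes "is_walk G (vs, es)" "inj_on h (set vs)" "h ` set vs \<subseteq> verts G'"
    and "\<And>e. e \<in> set es \<Longrightarrow> e \<in> edges G'"
    and "\<And>e v. e \<in> set es \<Longrightarrow> v \<in> set vs \<Longrightarrow> v \<in> ends G e \<Longrightarrow> h v \<in> ends G' e"
  shows "is_walk G' (map h vs, es)"
proof -
  have len: "length vs = Suc (length es)"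
    by (rule is_walk_length[OF assms(1)])
  have "h (vs ! i) \<noteq> h (vs ! Suc i) \<and> h (vs ! i) \<in> ends G' (es ! i) \<and>
      h (vs ! Suc i) \<in> ends G' (es ! i)" if i: "i < length es" for i
  proof -
    have "vs ! i \<in> set vs" "vs ! Suc i \<in> set vs" "es ! i \<in> set es"
      using i len by simp_all
    moreover have "vs ! i \<noteq> vs ! Suc i" "vs ! i \<in> ends G (es ! i)" "vs ! Suc i \<in> ends G (es ! i)"
      using assms(1) i by (simp_all add: is_walk_def)
    ultimately show ?thesis
      using assms(5) inj_onD[OF assms(2)] by blast
  qed
  with len assms(3,4) show ?thesis
    by (auto simp: is_walk_def)
qed

lemma is_walk_edge_joins:
  assumes "is_walk G (vs, es)" "e \<in> set es"
  obtains u v where "u \<in> set vs" "v \<in> set vs" "joins G e u v"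
proof -
  obtain i where i: "i < length es" "e = es ! i"
    using assms(2) by (auto simp: in_set_conv_nth)
  then have "joins G e (vs ! i) (vs ! Suc i)"
    using assms is_walk_edges[OF assms(1)] by (auto simp: is_walk_def joins_def)
  moreover have "vs ! i \<in> set vs" "vs ! Suc i \<in> set vs"
    using i is_walk_length[OF assms(1)] by simp_all
  ultimately show thesis
    using that by blast
qed

text \<open>A walk cannot leave or enter a vertex set that none of its edges crosses.\<close>

lemma is_walk_confined:
  assumes "is_walk G (vs, es)" "\<And>e. e \<in> set es \<Longrightarrow> ends G e \<subseteq> S \<or> ends G e \<inter> S = {}"
  shows "set vs \<subseteq> S \<or> set vs \<inter> S = {}"
  using assms
proof (induction es arbitrary: vs)
  case Nil
  then show ?case
    by (auto simp: is_walk_Nil)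
next
  case (Cons e es)
  then obtain v w ws where vs: "vs = v # w # ws" "joins G e v w" and "is_walk G (w # ws, es)"
    by (auto elim: is_walk_ConsE)
  then have "set (w # ws) \<subseteq> S \<or> set (w # ws) \<inter> S = {}"
    using Cons.prems(2) by (intro Cons.IH) simp_all
  moreover have "ends G e \<subseteq> S \<or> ends G e \<inter> S = {}"
    using Cons by simp
  ultimately show ?case
    using vs by (auto simp: joins_def)
qed

section \<open>Connected components\<close>

definition reachable :: "('v, 'e) pre_hypergraph \<Rightarrow> 'v \<Rightarrow> 'v \<Rightarrow> bool" where
  "reachable G u v \<longleftrightarrow> (\<exists>vs es. is_walk G (vs, es) \<and> hd vs = u \<and> last vs = v)"

lemma connected_hg_iff: "connected_hg G \<longleftrightarrow> (\<forall>u \<in> verts G. \<forall>v \<in> verts G. reachable G u v)"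
  by (simp add: connected_hg_def reachable_def)

lemma reachable_refl: "v \<in> verts G \<Longrightarrow> reachable G v v"
  unfolding reachable_def by (rule exI[of _ "[v]"], rule exI[of _ "[]"]) (simp add: is_walk_Nil)

lemma reachable_trans:
  assumes "reachable G u v" "reachable G v w"
  shows "reachable G u w"
proof -
  obtain us es ws fs where walks: "is_walk G (us, es)" "hd us = u" "last us = v"
    "is_walk G (ws, fs)" "hd ws = v" "last ws = w"
    using assms by (auto simp: reachable_def)
  then have "is_walk G (us @ tl ws, es @ fs)"
    by (simp add: is_walk_glue)
  moreover have "us \<noteq> []" "ws \<noteq> []"
    using walks by (auto dest: is_walk_nonempty)
  then have "hd (us @ tl ws) = u" "last (us @ tl ws) = w"
    using walks by (auto simp: last_append last_tl neq_Nil_conv split: if_splits)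
  ultimately show ?thesis
    unfolding reachable_def by blast
qed

lemma reachable_subhypergraph:
  assumes "subhypergraph K G" "reachable K u v"
  shows "reachable G u v"
proof -
  obtain vs es where "is_walk K (vs, es)" "hd vs = u" "last vs = v"
    using assms(2) by (auto simp: reachable_def)
  moreover from this assms(1) have "is_walk G (vs, es)"
    by (auto simp: is_walk_def subhypergraph_def)
  ultimately show ?thesis
    by (auto simp: reachable_def)
qed

lemma subhypergraph_trans:
  "subhypergraph K L \<Longrightarrow> subhypergraph L G \<Longrightarrow> subhypergraph K G"
  by (auto simp: subhypergraph_def)

text \<open>Among the connected subhypergraphs containing \<open>L\<close>, one with the most vertices and edges
  is maximal; it exists by finiteness.\<close>

lemma connected_sub_extends_to_component:
  assumes "hypergraph G" "connected_sub G L"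
  obtains K where "K \<in> components G" "subhypergraph L K"
proof -
  let ?P = "\<lambda>K. connected_sub G K \<and> subhypergraph L K"
  let ?size = "\<lambda>K. card (verts K) + card (edges K)"
  have "?P L"
    using assms(2) by (auto simp: connected_sub_def subhypergraph_def)
  moreover have "?size K \<le> ?size G" if "?P K" for K
    using that hypergraph.finite_verts[OF assms(1)] hypergraph.finite_edges[OF assms(1)]
    by (intro add_mono card_mono) (auto simp: connected_sub_def subhypergraph_def)
  ultimately obtain K where K: "?P K" and max: "\<And>M. ?P M \<Longrightarrow> ?size M \<le> ?size K"
    using ex_has_greatest_nat[of ?P L ?size "Suc (?size G)"] by (metis less_Suc_eq_le)
  have "M = K" if "connected_sub G M" "subhypergraph K M" for M
  proof -
    have M: "?P M"
      using that K subhypergraph_trans by blast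
    have sub: "verts K \<subseteq> verts M" "edges K \<subseteq> edges M" "ends K = ends M"
      and "hypergraph M"
      using that by (auto simp: subhypergraph_def connected_sub_def)
    then have fin: "finite (verts M)" "finite (edges M)"
      by (auto simp: hypergraph_def)
    then have "card (verts K) \<le> card (verts M)" "card (edges K) \<le> card (edges M)"
      using sub by (auto intro: card_mono)
    with max[OF M] have "card (verts K) = card (verts M)" "card (edges K) = card (edges M)"
      by linarith+
    then have "verts K = verts M" "edges K = edges M"
      using card_subset_eq[OF fin(1) sub(1)] card_subset_eq[OF fin(2) sub(2)] by blast+
    with sub show ?thesis
      by simp
  qed
  then have "K \<in> components G"
    using K by (simp add: components_def)
  with K that show thesis
    by blast
qed

lemma component_subhypergraph: "K \<in> components G \<Longrightarrow> subhypergraph K G"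
  by (simp add: components_def connected_sub_def)

lemma component_ends_subset:
  "K \<in> components G \<Longrightarrow> e \<in> edges K \<Longrightarrow> ends G e \<subseteq> verts K"
  using component_subhypergraph[of K G] hypergraph.ends_subset[of K e]
  by (auto simp: subhypergraph_def)

lemma component_verts_nonempty: "K \<in> components G \<Longrightarrow> verts K \<noteq> {}"
  using component_subhypergraph[of K G] hypergraph.verts_nonempty[of K]
  by (auto simp: subhypergraph_def)

lemma vertex_in_component:
  assumes "hypergraph G" "v \<in> verts G"
  obtains K where "K \<in> components G" "v \<in> verts K"
proof -
  let ?L = "\<lparr>verts = {v}, edges = {}, ends = ends G\<rparr>"
  have "connected_sub G ?L"
    using assms by (auto simp: connected_sub_def subhypergraph_def hypergraph_def
        connected_hg_iff reachable_refl)
  from connected_sub_extends_to_component[OF assms(1) this] that show thesis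
    by (auto simp: subhypergraph_def)
qed

lemma edge_in_component:
  assumes "hypergraph G" "e \<in> edges G" "ends G e \<noteq> {}"
  obtains K where "K \<in> components G" "e \<in> edges K"
proof -
  let ?L = "\<lparr>verts = ends G e, edges = {e}, ends = ends G\<rparr>"
  have "reachable ?L u v" if "u \<in> ends G e" "v \<in> ends G e" for u v
  proof (cases "u = v")
    case True
    then show ?thesis
      using that by (simp add: reachable_refl)
  next
    case False
    then have "is_walk ?L ([u, v], [e])"
      using that by (simp add: is_walk_Cons is_walk_Nil joins_def)
    then show ?thesis
      unfolding reachable_def by (intro exI[of _ "[u, v]"] exI[of _ "[e]"]) simp
  qed
  moreover have "finite (ends G e)"
    using assms(1,2) by (meson hypergraph_def finite_subset)
  ultimately have "connected_sub G ?L"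
    using assms by (auto simp: connected_sub_def subhypergraph_def connected_hg_iff
        hypergraph_def)
  from connected_sub_extends_to_component[OF assms(1) this] that show thesis
    by (auto simp: subhypergraph_def)
qed

text \<open>Two components with a common vertex \<open>x\<close> have a connected union, because every vertex of
  either one is joined to \<open>x\<close>; by maximality each of them equals this union.\<close>

lemma components_disjoint:
  assumes "K \<in> components G" "L \<in> components G" "K \<noteq> L"
  shows "verts K \<inter> verts L = {}"
proof (rule ccontr)
  assume "verts K \<inter> verts L \<noteq> {}"
  then obtain x where x: "x \<in> verts K" "x \<in> verts L"
    by auto
  have conn: "connected_sub G K" "connected_sub G L"
    and max: "\<And>M. connected_sub G M \<Longrightarrow> subhypergraph K M \<Longrightarrow> M = K"
    "\<And>M. connected_sub G M \<Longrightarrow> subhypergraph L M \<Longrightarrow> M = L"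
    using assms by (auto simp: components_def)
  define U where "U = \<lparr>verts = verts K \<union> verts L, edges = edges K \<union> edges L, ends = ends G\<rparr>"
  have hyp: "hypergraph K" "hypergraph L" and ends: "ends K = ends G" "ends L = ends G"
    using conn by (auto simp: connected_sub_def subhypergraph_def)
  then have "hypergraph U"
    unfolding hypergraph_def U_def by auto
  then have sub: "subhypergraph K U" "subhypergraph L U" "subhypergraph U G"
    using conn by (auto simp: U_def connected_sub_def subhypergraph_def)
  have to_x: "reachable U u x \<and> reachable U x u" if "u \<in> verts U" for u
  proof -
    have "u \<in> verts K \<or> u \<in> verts L"
      using that by (simp add: U_def)
    then have "(reachable K u x \<and> reachable K x u) \<or> (reachable L u x \<and> reachable L x u)"
      using conn x by (auto simp: connected_sub_def connected_hg_iff)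
    then show ?thesis
      using reachable_subhypergraph[OF sub(1)] reachable_subhypergraph[OF sub(2)] by blast
  qed
  then have "connected_hg U"
    unfolding connected_hg_iff by (blast intro: reachable_trans)
  moreover have "\<forall>e \<in> edges U. ends U e \<noteq> {}"
    using conn ends by (auto simp: U_def connected_sub_def)
  ultimately have "connected_sub G U"
    using sub by (simp add: connected_sub_def)
  with max sub have "U = K" "U = L"
    by auto
  with assms(3) show False
    by simp
qed

section \<open>Euler tours as two arcs between two chosen edges\<close>

text \<open>Read cyclically, the tour is \<open>p\<close>, then \<open>f2\<close>, then \<open>q\<close>, then \<open>f1\<close>.\<close>

definition two_arc_tour ::
    "('v, 'e) pre_hypergraph \<Rightarrow> 'e \<Rightarrow> 'e \<Rightarrow> ('v, 'e) walk \<Rightarrow> ('v, 'e) walk \<Rightarrow> bool" where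
  "two_arc_tour G f1 f2 p q \<longleftrightarrow> is_walk G p \<and> is_walk G q \<and>
     joins G f2 (last (fst p)) (hd (fst q)) \<and> joins G f1 (last (fst q)) (hd (fst p)) \<and>
     distinct (snd p @ f2 # snd q @ [f1]) \<and> set (snd p @ f2 # snd q @ [f1]) = edges G"

abbreviation rev_walk :: "('v, 'e) walk \<Rightarrow> ('v, 'e) walk" where
  "rev_walk p \<equiv> (rev (fst p), rev (snd p))"

text \<open>Reversing a tour exchanges its two arcs but keeps the roles of \<open>f1\<close> and \<open>f2\<close>, so either
  arc may be chosen to come first.\<close>

lemma two_arc_tour_rev:
  assumes "two_arc_tour G f1 f2 p q"
  shows "two_arc_tour G f1 f2 (rev_walk q) (rev_walk p)"
proof -
  obtain ps es qs fs where pq: "p = (ps, es)" "q = (qs, fs)"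
    by (cases p, cases q)
  have walks: "is_walk G (ps, es)" "is_walk G (qs, fs)"
    using assms by (auto simp: two_arc_tour_def pq)
  with assms show ?thesis
    by (auto simp: two_arc_tour_def pq is_walk_rev is_walk_nonempty hd_rev last_rev joins_commute)
qed

lemma two_arc_tour_swap:
  "two_arc_tour G f1 f2 p q \<Longrightarrow> two_arc_tour G f2 f1 q p"
  by (auto simp: two_arc_tour_def)

lemma euler_tour_imp_two_arc_tour:
  assumes "euler_tour G T" "f1 \<in> edges G" "f2 \<in> edges G" "f1 \<noteq> f2"
  obtains p q where "two_arc_tour G f1 f2 p q" "anchors T = anchors p \<union> anchors q"
proof -
  obtain vs es where T: "T = (vs, es)"
    by (cases T)
  have tour: "is_walk G (vs, es)" "distinct es" "hd vs = last vs" "set es = edges G"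
    using assms(1) by (auto simp: T euler_tour_def strict_trail_def closed_walk_def)
  have *: "\<exists>p q. two_arc_tour G a b p q \<and> anchors T = anchors p \<union> anchors q"
    if es: "es = xs @ a # ys @ b # zs" for a b xs ys zs
  proof -
    from tour(1) obtain A BC where vs1: "vs = A @ BC" and A: "is_walk G (A, xs)"
      and jA: "joins G a (last A) (hd BC)" and BC: "is_walk G (BC, ys @ b # zs)"
      unfolding es by (rule is_walk_splitE)
    from BC obtain B C where BC': "BC = B @ C" and B: "is_walk G (B, ys)"
      and jB: "joins G b (last B) (hd C)" and C: "is_walk G (C, zs)"
      by (rule is_walk_splitE)
    note vs = vs1[unfolded BC'] and walks = A B C and joins = jA[unfolded BC'] jB
    have ne: "A \<noteq> []" "B \<noteq> []" "C \<noteq> []"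
      using walks by (auto dest: is_walk_nonempty)
    \<comment> \<open>The two outer pieces of the closed walk meet at its starting point.\<close>
    have meet: "last C = hd A"
      using tour(3) ne by (simp add: vs)
    then have CA: "is_walk G (C @ tl A, zs @ xs)"
      by (intro is_walk_glue walks)
    have "last (C @ tl A) = last A" "hd (C @ tl A) = hd C"
      using ne meet by (auto simp: last_append neq_Nil_conv)
    moreover have "set (C @ tl A) = set C \<union> set A"
      using ne meet last_in_set[of C] by (cases A) auto
    ultimately have "two_arc_tour G a b (B, ys) (C @ tl A, zs @ xs)"
      "anchors T = anchors (B, ys) \<union> anchors (C @ tl A, zs @ xs)"
      using CA walks joins ne tour(2,4)
      by (auto simp: two_arc_tour_def anchors_def T vs es)
    then show ?thesis
      by blast
  qed
  have "f1 \<in> set es" "f2 \<in> set es"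
    using assms tour by auto
  then obtain xs ys where es: "es = xs @ f1 # ys"
    by (meson split_list)
  consider "f2 \<in> set ys" | "f2 \<in> set xs"
    using \<open>f2 \<in> set es\<close> assms(4) es by auto
  then show thesis
  proof cases
    case 1
    then obtain ys1 ys2 where "ys = ys1 @ f2 # ys2"
      by (meson split_list)
    with * es that show thesis
      by blast
  next
    case 2
    then obtain xs1 xs2 where "xs = xs1 @ f2 # xs2"
      by (meson split_list)
    with *[of xs1 f2 xs2 f1 ys] es obtain p q where
      "two_arc_tour G f2 f1 p q" "anchors T = anchors p \<union> anchors q"
      by auto
    then show thesis
      using that[of q p] two_arc_tour_swap[of G f2 f1 p q] by (simp add: Un_commute)
  qed
qed

lemma two_arc_tour_imp_euler_tour:
  assumes "two_arc_tour G f1 f2 p q"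
  obtains T where "euler_tour G T" "anchors T = anchors p \<union> anchors q"
proof -
  obtain ps es qs fs where pq: "p = (ps, es)" "q = (qs, fs)"
    by (cases p, cases q)
  have arcs: "is_walk G (ps, es)" "is_walk G (qs, fs)"
    "joins G f2 (last ps) (hd qs)" "joins G f1 (last qs) (hd ps)"
    "distinct (es @ f2 # fs @ [f1])" "set (es @ f2 # fs @ [f1]) = edges G"
    using assms by (auto simp: two_arc_tour_def pq)
  have ne: "ps \<noteq> []" "qs \<noteq> []"
    using arcs by (auto dest: is_walk_nonempty)
  then have "hd ps \<in> verts G"
    using is_walk_verts[OF arcs(1)] by auto
  then have "is_walk G (qs @ [hd ps], fs @ [f1])"
    using arcs is_walk_length[OF arcs(2)] by (simp add: is_walk_append_iff is_walk_Nil)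
  then have "is_walk G (ps @ qs @ [hd ps], es @ f2 # fs @ [f1])"
    using arcs ne is_walk_length[OF arcs(1)] by (subst is_walk_append_iff) simp_all
  then have "euler_tour G (ps @ qs @ [hd ps], es @ f2 # fs @ [f1])"
    using arcs ne by (simp add: euler_tour_def strict_trail_def closed_walk_def)
  moreover have "anchors (ps @ qs @ [hd ps], es @ f2 # fs @ [f1]) = anchors p \<union> anchors q"
    using ne by (auto simp: anchors_def pq)
  ultimately show thesis
    using that by blast
qed

section \<open>Minimal edge cuts of size two\<close>

locale two_edge_cut = hypergraph H for H :: "('v, 'e) pre_hypergraph" +
  fixes f1 f2 :: 'e
  assumes card_ends: "e \<in> edges H \<Longrightarrow> 2 \<le> card (ends H e)"
    and distinct_cut_edges: "f1 \<noteq> f2"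
    and min_cut: "minimal_edge_cut H {f1, f2}"
begin

abbreviation comps :: "('v, 'e) pre_hypergraph set" where
  "comps \<equiv> components (del_edges H {f1, f2})"

abbreviation star :: "('v, 'e) pre_hypergraph \<Rightarrow> ('v option, 'e) pre_hypergraph" where
  "star K \<equiv> collapse_others H {f1, f2} K"

lemma cut_edges: "f1 \<in> edges H" "f2 \<in> edges H"
proof -
  obtain S where "{f1, f2} = cut H S"
    using min_cut unfolding minimal_edge_cut_def edge_cut_def by blast
  then have "{f1, f2} \<subseteq> edges H"
    unfolding cut_def by blast
  then show "f1 \<in> edges H" "f2 \<in> edges H"
    by simp_all
qed

lemma finite_ends: "e \<in> edges H \<Longrightarrow> finite (ends H e)"
  by (rule finite_subset[OF ends_subset finite_verts])

lemma ends_nonempty: "e \<in> edges H \<Longrightarrow> ends H e \<noteq> {}"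
  using card_ends[of e] by fastforce

lemma hypergraph_del: "hypergraph (del_edges H {f1, f2})"
  using verts_nonempty finite_verts finite_edges ends_subset
  by (auto simp: hypergraph_def del_edges_def)

lemma del_simps [simp]:
  "verts (del_edges H {f1, f2}) = verts H"
  "edges (del_edges H {f1, f2}) = edges H - {f1, f2}"
  "ends (del_edges H {f1, f2}) = ends H"
  by (simp_all add: del_edges_def)

lemma comp_sub:
  assumes "K \<in> comps"
  shows "verts K \<subseteq> verts H" "edges K \<subseteq> edges H - {f1, f2}" "ends K = ends H"
  using component_subhypergraph[OF assms] by (auto simp: subhypergraph_def)

lemma verts_H: "verts H = (\<Union>K \<in> comps. verts K)"
proof
  show "verts H \<subseteq> (\<Union>K \<in> comps. verts K)"
  proof
    fix v assume "v \<in> verts H"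
    then obtain K where "K \<in> comps" "v \<in> verts K"
      using vertex_in_component[OF hypergraph_del, of v] by auto
    then show "v \<in> (\<Union>K \<in> comps. verts K)"
      by blast
  qed
  show "(\<Union>K \<in> comps. verts K) \<subseteq> verts H"
    using comp_sub(1) by blast
qed

lemma edges_H: "edges H = (\<Union>K \<in> comps. edges K) \<union> {f1, f2}"
proof
  show "edges H \<subseteq> (\<Union>K \<in> comps. edges K) \<union> {f1, f2}"
  proof
    fix e assume e: "e \<in> edges H"
    show "e \<in> (\<Union>K \<in> comps. edges K) \<union> {f1, f2}"
    proof (cases "e \<in> {f1, f2}")
      case False
      then obtain K where "K \<in> comps" "e \<in> edges K"
        using edge_in_component[OF hypergraph_del, of e] e ends_nonempty[OF e] by auto
      then show ?thesis
        by blast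
    qed blast
  qed
  show "(\<Union>K \<in> comps. edges K) \<union> {f1, f2} \<subseteq> edges H"
    using comp_sub(2) cut_edges by blast
qed

lemma comp_ends_subset: "K \<in> comps \<Longrightarrow> e \<in> edges K \<Longrightarrow> ends H e \<subseteq> verts K"
  using component_ends_subset[of K "del_edges H {f1, f2}" e] by simp

lemma edge_meets_comp:
  assumes "K \<in> comps" "e \<in> edges H - {f1, f2}" "ends H e \<inter> verts K \<noteq> {}"
  shows "e \<in> edges K"
proof -
  obtain L where L: "L \<in> comps" "e \<in> edges L"
    using assms(2) edges_H by auto
  then have "verts K \<inter> verts L \<noteq> {}"
    using assms(3) comp_ends_subset by blast
  with components_disjoint[OF assms(1) L(1)] L(2) show ?thesis
    by auto
qed

text \<open>The edges leaving a component all belong to the cut, so they form an edge cut inside it;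
  by minimality they are the whole cut. Hence each cut edge meets every component.\<close>

lemma cut_comp:
  assumes "K \<in> comps" "L \<in> comps" "K \<noteq> L"
  shows "cut H (verts K) = {f1, f2}"
proof -
  have "verts K \<inter> verts L = {}"
    by (rule components_disjoint[OF assms])
  then have "verts K \<subset> verts H"
    using component_verts_nonempty[OF assms(2)] comp_sub(1)[OF assms(1)] comp_sub(1)[OF assms(2)]
    by blast
  then have "edge_cut H (cut H (verts K))"
    using component_verts_nonempty[OF assms(1)] unfolding edge_cut_def by blast
  moreover have "cut H (verts K) \<subseteq> {f1, f2}"
  proof
    fix e assume "e \<in> cut H (verts K)"
    then have e: "e \<in> edges H" "ends H e \<inter> verts K \<noteq> {}" "\<not> ends H e \<subseteq> verts K"
      by (auto simp: cut_def)
    then have "e \<notin> edges K"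
      using comp_ends_subset[OF assms(1)] by blast
    with edge_meets_comp[OF assms(1)] e(1,2) show "e \<in> {f1, f2}"
      by blast
  qed
  ultimately show ?thesis
    using min_cut unfolding minimal_edge_cut_def by blast
qed

lemma cut_edge_meets_comp:
  assumes "K \<in> comps" "L \<in> comps" "K \<noteq> L" "f \<in> {f1, f2}"
  shows "ends H f \<inter> verts K \<noteq> {}"
  using assms(4) unfolding cut_comp[OF assms(1-3), symmetric] cut_def by blast

lemma walk_in_comp:
  assumes "is_walk H (vs, es)" "f1 \<notin> set es" "f2 \<notin> set es"
  obtains K where "K \<in> comps" "is_walk K (vs, es)"
proof -
  have "vs \<noteq> []"
    by (rule is_walk_nonempty[OF assms(1)])
  then have "hd vs \<in> set vs" "hd vs \<in> verts H"
    using is_walk_verts[OF assms(1)] by auto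
  then obtain K where K: "K \<in> comps" "hd vs \<in> verts K"
    by (auto simp: verts_H)
  have es: "set es \<subseteq> edges H - {f1, f2}"
    using is_walk_edges[OF assms(1)] assms by auto
  have "ends H e \<subseteq> verts K \<or> ends H e \<inter> verts K = {}" if "e \<in> set es" for e
    using that es edge_meets_comp[OF K(1)] comp_ends_subset[OF K(1)] by blast
  then have vs: "set vs \<subseteq> verts K"
    using is_walk_confined[OF assms(1)] \<open>hd vs \<in> set vs\<close> K(2) by blast
  have "e \<in> edges K" if "e \<in> set es" for e
  proof -
    from assms(1) that obtain u v where "u \<in> set vs" "joins H e u v"
      by (rule is_walk_edge_joins)
    then show ?thesis
      using vs that es by (intro edge_meets_comp[OF K(1)]) (auto simp: joins_def)
  qed
  then have "is_walk K (map id vs, es)"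
    using vs comp_sub(3)[OF K(1)] by (intro is_walk_map[OF assms(1)]) auto
  with K(1) that show thesis
    by simp
qed

lemma comp_walk:
  assumes "K \<in> comps" "is_walk K (vs, es)"
  shows "is_walk H (vs, es)"
proof -
  have "set vs \<subseteq> verts H"
    using is_walk_verts[OF assms(2)] comp_sub(1)[OF assms(1)] by (rule subset_trans)
  moreover have "set es \<subseteq> edges H"
    using is_walk_edges[OF assms(2)] comp_sub(2)[OF assms(1)] by fast
  ultimately show ?thesis
    using assms(2) by (simp add: is_walk_def comp_sub(3)[OF assms(1)])
qed

text \<open>The part of an Euler tour that runs through the component \<open>K\<close>; both the tours of \<open>H\<close> and
  those of the collapsed hypergraphs are assembled from such pieces. The direction from \<open>f1\<close> to
  \<open>f2\<close> is fixed by convention, since reversing a tour makes either direction available.\<close>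

definition comp_arc :: "('v, 'e) pre_hypergraph \<Rightarrow> ('v, 'e) walk \<Rightarrow> bool" where
  "comp_arc K p \<longleftrightarrow> is_walk K p \<and> distinct (snd p) \<and> set (snd p) = edges K \<and>
     hd (fst p) \<in> ends H f1 \<and> last (fst p) \<in> ends H f2"

section \<open>Tours of the collapsed hypergraphs\<close>

lemma verts_outside_comp:
  assumes "K \<in> comps"
  shows "verts H - (\<Union>L \<in> comps - {K}. verts L) = verts K"
  using components_disjoint[OF assms] assms by (auto simp: verts_H)

lemma star_verts: "K \<in> comps \<Longrightarrow> verts (star K) = insert None (Some ` verts K)"
  by (simp add: collapse_others_def collapse_def verts_outside_comp)

lemma star_ends_comp:
  assumes "K \<in> comps" "e \<in> edges K"
  shows "ends (star K) e = Some ` ends H e"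
proof -
  have "ends H e \<inter> (\<Union>L \<in> comps - {K}. verts L) = {}"
    using comp_ends_subset[OF assms] verts_outside_comp[OF assms(1)] by blast
  then show ?thesis
    by (simp add: collapse_others_def collapse_def collapse_ends_def)
qed

lemma star_ends_cut:
  assumes "K \<in> comps" "L \<in> comps" "K \<noteq> L" "f \<in> {f1, f2}"
  shows "ends (star K) f = insert None (Some ` (ends H f \<inter> verts K))"
proof -
  have "ends H f \<inter> (\<Union>L \<in> comps - {K}. verts L) \<noteq> {}"
    using cut_edge_meets_comp[of L K f] assms by blast
  then show ?thesis
    using assms(1) by (simp add: collapse_others_def collapse_def collapse_ends_def
        verts_outside_comp)
qed

text \<open>An edge of another component collapses to the single vertex \<open>None\<close> and is discarded,
  whereas a cut edge keeps an old vertex next to \<open>None\<close>.\<close>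

lemma star_edges:
  assumes "K \<in> comps" "L \<in> comps" "K \<noteq> L"
  shows "edges (star K) = edges K \<union> {f1, f2}"
proof -
  have edges_star: "edges (star K) = {e \<in> edges H. \<not> card (ends (star K) e) < 2}"
    by (simp add: collapse_others_def collapse_def)
  have comp: "\<not> card (ends (star K) e) < 2" "e \<in> edges H" if "e \<in> edges K" for e
    using that comp_sub(2)[OF assms(1)] card_ends[of e]
    by (auto simp: star_ends_comp[OF assms(1)] card_image)
  have cut: "\<not> card (ends (star K) f) < 2" "f \<in> edges H" if f: "f \<in> {f1, f2}" for f
  proof -
    obtain x where "x \<in> ends H f \<inter> verts K"
      using cut_edge_meets_comp[OF assms f] by blast
    then have "{None, Some x} \<subseteq> ends (star K) f"
      by (auto simp: star_ends_cut[OF assms f])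
    moreover show f': "f \<in> edges H"
      using f cut_edges by auto
    then have "finite (ends (star K) f)"
      by (simp add: star_ends_cut[OF assms f] finite_ends)
    ultimately have "card {None, Some x} \<le> card (ends (star K) f)"
      by (intro card_mono)
    then show "\<not> card (ends (star K) f) < 2"
      by simp
  qed
  have other: "card (ends (star K) e) < 2" if e: "e \<in> edges H" "e \<notin> edges K" "e \<notin> {f1, f2}" for e
  proof -
    obtain M where M: "M \<in> comps" "e \<in> edges M"
      using e edges_H by auto
    with e have "M \<noteq> K"
      by auto
    have "ends H e \<inter> verts K = {}"
      using edge_meets_comp[OF assms(1)] e by blast
    moreover have "ends H e \<inter> (\<Union>L \<in> comps - {K}. verts L) \<noteq> {}"
      using comp_ends_subset[OF M] M \<open>M \<noteq> K\<close> ends_nonempty[OF e(1)] by blast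
    ultimately have "ends (star K) e = {None}"
      using assms(1) by (simp add: collapse_others_def collapse_def collapse_ends_def
          verts_outside_comp)
    then show ?thesis
      by simp
  qed
  show ?thesis
    unfolding edges_star using comp cut other by blast
qed

text \<open>Replacing the rest of the hypergraph by the collapsed vertex closes an arc to a tour: the
  second arc of the tour is the trivial walk at \<open>None\<close>.\<close>

lemma comp_arc_imp_star_tour:
  assumes "K \<in> comps" "L \<in> comps" "K \<noteq> L" "comp_arc K p"
  obtains T where "euler_tour (star K) T" "anchors T = insert None (Some ` anchors p)"
proof -
  obtain vs es where p: "p = (vs, es)"
    by (cases p)
  have arc: "is_walk K (vs, es)" "distinct es" "set es = edges K"
    "hd vs \<in> ends H f1" "last vs \<in> ends H f2"
    using assms(4) by (auto simp: comp_arc_def p)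
  note ends = star_ends_comp[OF assms(1)] star_ends_cut[OF assms(1-3)]
  have "vs \<noteq> []" and vs: "set vs \<subseteq> verts K"
    using arc(1) by (auto dest: is_walk_nonempty is_walk_verts)
  then have "hd vs \<in> verts K" "last vs \<in> verts K"
    by auto
  then have joins: "joins (star K) f2 (Some (last vs)) None" "joins (star K) f1 None (Some (hd vs))"
    using arc by (auto simp: joins_def ends star_edges[OF assms(1-3)])
  have "is_walk (star K) (map Some vs, es)"
    using vs arc(3) comp_sub(3)[OF assms(1)]
    by (intro is_walk_map[OF arc(1)])
      (auto simp: star_verts[OF assms(1)] star_edges[OF assms(1-3)] ends)
  moreover have "is_walk (star K) ([None], [])"
    by (simp add: is_walk_Nil star_verts[OF assms(1)])
  ultimately have "two_arc_tour (star K) f1 f2 (map Some vs, es) ([None], [])"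
    using joins arc \<open>vs \<noteq> []\<close> comp_sub(2)[OF assms(1)] distinct_cut_edges
    by (auto simp: two_arc_tour_def star_edges[OF assms(1-3)] hd_map last_map)
  from two_arc_tour_imp_euler_tour[OF this] that show thesis
    by (auto simp: anchors_def p)
qed

text \<open>Apart from the cut edges no edge contains \<open>None\<close>, so the arc that visits \<open>None\<close> is trivial.
  The other arc cannot visit \<open>None\<close> as well, because \<open>f1\<close> joins two different vertices; so it
  lies in \<open>K\<close> and uses all of its edges.\<close>

lemma star_tour_imp_comp_arc:
  assumes "K \<in> comps" "L \<in> comps" "K \<noteq> L"
    and "euler_tour (star K) T" "None \<in> anchors T"
  obtains p where "comp_arc K p" "anchors T = insert None (Some ` anchors p)"
proof -
  note ends = star_ends_comp[OF assms(1)] star_ends_cut[OF assms(1-3)]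
  note edges = star_edges[OF assms(1-3)]
  have "f1 \<in> edges (star K)" "f2 \<in> edges (star K)"
    by (simp_all add: edges)
  then obtain p q where pq: "two_arc_tour (star K) f1 f2 p q" "anchors T = anchors p \<union> anchors q"
    using euler_tour_imp_two_arc_tour[OF assms(4) _ _ distinct_cut_edges] by blast
  have "\<exists>p q. two_arc_tour (star K) f1 f2 p q \<and> anchors T = anchors p \<union> anchors q \<and>
      None \<in> anchors q"
  proof (cases "None \<in> anchors q")
    case True
    with pq show ?thesis
      by blast
  next
    case False
    with assms(5) pq have "None \<in> anchors (rev_walk p)"
      "anchors T = anchors (rev_walk q) \<union> anchors (rev_walk p)"
      by (auto simp: anchors_def)
    with two_arc_tour_rev[OF pq(1)] show ?thesis
      by blast
  qed
  then obtain vs es ws fs where tour: "two_arc_tour (star K) f1 f2 (vs, es) (ws, fs)"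
    and anchors: "anchors T = set vs \<union> set ws" and None: "None \<in> set ws"
    by (auto simp: anchors_def)
  have arcs: "is_walk (star K) (vs, es)" "is_walk (star K) (ws, fs)"
    "joins (star K) f2 (last vs) (hd ws)" "joins (star K) f1 (last ws) (hd vs)"
    "distinct (es @ f2 # fs @ [f1])" "set (es @ f2 # fs @ [f1]) = edges (star K)"
    using tour by (auto simp: two_arc_tour_def)
  have in_K: "e \<in> edges K" if "e \<in> set es \<union> set fs" for e
    using that arcs(5,6) by (auto simp: edges)
  have off_None: "ends (star K) e \<subseteq> {None} \<or> ends (star K) e \<inter> {None} = {}"
    if "e \<in> set es \<union> set fs" for e
    using in_K[OF that] by (auto simp: ends)
  have ws_None: "set ws \<subseteq> {None}"
    using is_walk_confined[OF arcs(2), of "{None}"] off_None None by blast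
  have "fs = []"
  proof (rule ccontr)
    assume "fs \<noteq> []"
    then have "hd fs \<in> set fs"
      by simp
    from arcs(2) this obtain u v where "u \<in> set ws" "v \<in> set ws" "joins (star K) (hd fs) u v"
      by (rule is_walk_edge_joins)
    with ws_None show False
      by (auto simp: joins_def)
  qed
  with arcs(2) ws_None have ws: "ws = [None]"
    by (auto simp: is_walk_Nil)
  have "vs \<noteq> []"
    by (rule is_walk_nonempty[OF arcs(1)])
  then have "hd vs \<in> set vs" "hd vs \<notin> {None}"
    using arcs(4) unfolding ws joins_def by (simp, metis last.simps singletonD)
  moreover have "set vs \<subseteq> {None} \<or> set vs \<inter> {None} = {}"
    by (rule is_walk_confined[OF arcs(1) off_None]) simp
  ultimately have no_None: "None \<notin> set vs"
    by (metis disjoint_iff singletonI subsetD)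
  have vs: "set vs \<subseteq> Some ` verts K"
    using is_walk_verts[OF arcs(1)] no_None by (auto simp: star_verts[OF assms(1)])
  have "is_walk K (map the vs, es)"
  proof (rule is_walk_map[OF arcs(1)])
    show "inj_on the (set vs)"
      using no_None by (intro inj_onI) (metis option.expand)
    show "the ` set vs \<subseteq> verts K"
      using vs by auto
    show "e \<in> edges K" if "e \<in> set es" for e
      using that in_K by simp
    show "the v \<in> ends K e" if "e \<in> set es" "v \<in> ends (star K) e" for e v
      using that in_K[of e] by (auto simp: ends comp_sub(3)[OF assms(1)])
  qed
  moreover have "hd (map the vs) \<in> ends H f1" "last (map the vs) \<in> ends H f2"
    using arcs(3,4) \<open>vs \<noteq> []\<close> by (auto simp: joins_def ends ws hd_map last_map)
  moreover have "set es = edges K"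
    using arcs(5,6) comp_sub(2)[OF assms(1)] by (auto simp: edges \<open>fs = []\<close>)
  ultimately have "comp_arc K (map the vs, es)"
    using arcs(5) by (simp add: comp_arc_def)
  moreover have "anchors T = insert None (Some ` anchors (map the vs, es))"
  proof -
    have "Some (the v) = v" if "v \<in> set vs" for v
      using that vs by auto
    then have "Some ` the ` set vs = set vs"
      by (simp add: image_image)
    then show ?thesis
      unfolding anchors by (simp add: anchors_def ws)
  qed
  ultimately show thesis
    using that by blast
qed

section \<open>Tours of the whole hypergraph\<close>

lemma comp_edges_disjoint:
  assumes "K \<in> comps" "L \<in> comps" "K \<noteq> L"
  shows "edges K \<inter> edges L = {}"
  using components_disjoint[OF assms] comp_ends_subset[OF assms(1)] comp_ends_subset[OF assms(2)]
    comp_sub(2)[OF assms(1)] ends_nonempty by blast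

lemma edges_two_comps:
  assumes "H1 \<in> comps" "H2 \<in> comps" "\<And>K. K \<in> comps - {H1, H2} \<Longrightarrow> edges K = {}"
  shows "edges H = edges H1 \<union> edges H2 \<union> {f1, f2}"
  using edges_H assms by blast

lemma tour_imp_comp_arcs:
  assumes comps: "H1 \<in> comps" "H2 \<in> comps" "H1 \<noteq> H2" and ne: "edges H1 \<noteq> {}" "edges H2 \<noteq> {}"
    and empty: "\<And>K. K \<in> comps - {H1, H2} \<Longrightarrow> edges K = {}"
    and tour: "euler_tour H T"
  obtains p q where "comp_arc H1 p" "comp_arc H2 q" "anchors T = anchors p \<union> anchors q"
proof -
  have edges: "edges H = edges H1 \<union> edges H2 \<union> {f1, f2}"
    by (rule edges_two_comps[OF comps(1,2) empty])
  obtain p q where pq: "two_arc_tour H f1 f2 p q" "anchors T = anchors p \<union> anchors q"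
    using euler_tour_imp_two_arc_tour[OF tour cut_edges distinct_cut_edges] by blast
  \<comment> \<open>Each arc stays in one component, and together they must cover the edges of both
    \<open>H1\<close> and \<open>H2\<close>.\<close>
  have split: "\<exists>K L. is_walk K p \<and> is_walk L q \<and> {K, L} = {H1, H2}"
    if "two_arc_tour H f1 f2 p q" for p q
  proof -
    obtain vs es ws fs where [simp]: "p = (vs, es)" "q = (ws, fs)"
      by (cases p, cases q)
    have arcs: "is_walk H (vs, es)" "is_walk H (ws, fs)"
      "distinct (es @ f2 # fs @ [f1])" "set (es @ f2 # fs @ [f1]) = edges H"
      using that by (auto simp: two_arc_tour_def)
    have "f1 \<notin> set es" "f2 \<notin> set es" "f1 \<notin> set fs" "f2 \<notin> set fs"
      using arcs(3) by auto
    then obtain K L where K: "K \<in> comps" "is_walk K (vs, es)"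
      and L: "L \<in> comps" "is_walk L (ws, fs)"
      using arcs(1,2) by (metis walk_in_comp)
    have cover: "edges M \<subseteq> edges K \<union> edges L" if "M \<in> comps" for M
      using arcs(4) is_walk_edges[OF K(2)] is_walk_edges[OF L(2)] comp_sub(2)[OF that] by auto
    have "M = K \<or> M = L" if "M \<in> comps" "edges M \<noteq> {}" for M
      using cover[OF that(1)] that(2) comp_edges_disjoint[OF that(1) K(1)]
        comp_edges_disjoint[OF that(1) L(1)] by blast
    then have "{K, L} = {H1, H2}"
      using comps ne by blast
    with K L show ?thesis
      by auto
  qed
  \<comment> \<open>The tour enters its second arc through \<open>f2\<close>, whereas a component arc starts at \<open>f1\<close>.\<close>
  have arcs: "comp_arc H1 p \<and> comp_arc H2 (rev_walk q)"
    if t: "two_arc_tour H f1 f2 p q" and w: "is_walk H1 p" "is_walk H2 q" for p q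
  proof -
    have "set (snd p) \<subseteq> edges H1" "set (snd q) \<subseteq> edges H2"
      using w is_walk_edges by (metis prod.collapse)+
    moreover have "set (snd p) \<union> set (snd q) \<union> {f1, f2} = edges H"
      using t by (auto simp: two_arc_tour_def)
    ultimately have "set (snd p) = edges H1" "set (snd q) = edges H2"
      using comp_edges_disjoint[OF comps] comp_sub(2)[OF comps(1)] comp_sub(2)[OF comps(2)] edges
      by blast+
    moreover have "distinct (snd p)" "distinct (snd q)"
      "joins H f2 (last (fst p)) (hd (fst q))" "joins H f1 (last (fst q)) (hd (fst p))"
      using t by (auto simp: two_arc_tour_def)
    moreover have "is_walk H2 (rev_walk q)" "fst q \<noteq> []"
      using w(2) is_walk_rev[of H2 "fst q" "snd q"] is_walk_nonempty[of H2 "fst q" "snd q"]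
      by simp_all
    ultimately show ?thesis
      using w(1) by (auto simp: comp_arc_def joins_def hd_rev last_rev)
  qed
  from split[OF pq(1)] consider "is_walk H1 p" "is_walk H2 q" | "is_walk H2 p" "is_walk H1 q"
    by (auto simp: doubleton_eq_iff)
  then show thesis
  proof cases
    case 1
    then have "comp_arc H1 p" "comp_arc H2 (rev_walk q)"
      using arcs[OF pq(1)] by simp_all
    moreover have "anchors T = anchors p \<union> anchors (rev_walk q)"
      using pq(2) by (auto simp: anchors_def)
    ultimately show thesis
      using that by blast
  next
    case 2
    then have "is_walk H1 (rev_walk q)" "is_walk H2 (rev_walk p)"
      by (simp_all add: is_walk_rev)
    from arcs[OF two_arc_tour_rev[OF pq(1)] this]
    have "comp_arc H1 (rev_walk q)" "comp_arc H2 p"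
      by simp_all
    moreover have "anchors T = anchors (rev_walk q) \<union> anchors p"
      using pq(2) by (auto simp: anchors_def)
    ultimately show thesis
      using that by blast
  qed
qed

text \<open>Both arcs run from \<open>f1\<close> to \<open>f2\<close>, so the second one has to be traversed backwards.\<close>

lemma comp_arcs_imp_tour:
  assumes comps: "H1 \<in> comps" "H2 \<in> comps" "H1 \<noteq> H2"
    and empty: "\<And>K. K \<in> comps - {H1, H2} \<Longrightarrow> edges K = {}"
    and arcs: "comp_arc H1 p" "comp_arc H2 q"
  obtains T where "euler_tour H T" "anchors T = anchors p \<union> anchors q"
proof -
  obtain vs es ws fs where pq: "p = (vs, es)" "q = (ws, fs)"
    by (cases p, cases q)
  have p: "is_walk H1 (vs, es)" "distinct es" "set es = edges H1"
      "hd vs \<in> ends H f1" "last vs \<in> ends H f2"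
    and q: "is_walk H2 (ws, fs)" "distinct fs" "set fs = edges H2"
      "hd ws \<in> ends H f1" "last ws \<in> ends H f2"
    using arcs by (auto simp: comp_arc_def pq)
  have ne: "vs \<noteq> []" "ws \<noteq> []"
    using p(1) q(1) by (auto dest: is_walk_nonempty)
  have "u \<noteq> w" if "u \<in> set vs" "w \<in> set ws" for u w
    using that is_walk_verts[OF p(1)] is_walk_verts[OF q(1)] components_disjoint[OF comps]
    by blast
  then have "last vs \<noteq> last ws" "hd ws \<noteq> hd vs"
    using ne by (metis last_in_set, metis hd_in_set)
  then have "joins H f2 (last vs) (hd (rev ws))" "joins H f1 (last (rev ws)) (hd vs)"
    using p q ne cut_edges by (auto simp: joins_def hd_rev last_rev)
  moreover have "distinct (es @ f2 # rev fs @ [f1])"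
  proof -
    have "set es \<inter> set fs = {}"
      using comp_edges_disjoint[OF comps] p(3) q(3) by simp
    moreover have "f1 \<notin> set es" "f2 \<notin> set es" "f1 \<notin> set fs" "f2 \<notin> set fs"
      using comp_sub(2)[OF comps(1)] comp_sub(2)[OF comps(2)] p(3) q(3) by fast+
    ultimately show ?thesis
      using p(2) q(2) distinct_cut_edges by auto
  qed
  moreover have "set (es @ f2 # rev fs @ [f1]) = edges H"
  proof -
    have "edges H = edges H1 \<union> edges H2 \<union> {f1, f2}"
      by (rule edges_two_comps[OF comps(1,2) empty])
    then show ?thesis
      using p(3) q(3) by auto
  qed
  ultimately have "two_arc_tour H f1 f2 p (rev_walk q)"
    using comp_walk[OF comps(1) p(1)] is_walk_rev[OF comp_walk[OF comps(2) q(1)]]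
    by (simp add: two_arc_tour_def pq)
  from two_arc_tour_imp_euler_tour[OF this] that show thesis
    by (auto simp: anchors_def)
qed

lemma spanning_star_iff:
  assumes "K \<in> comps" "anchors T = insert None (Some ` anchors p)"
  shows "spanning (star K) T \<longleftrightarrow> verts K \<subseteq> anchors p"
  using assms by (auto simp: spanning_def star_verts)

lemma comp_arc_anchors: "comp_arc K p \<Longrightarrow> anchors p \<subseteq> verts K"
  by (cases p) (auto simp: comp_arc_def anchors_def dest: is_walk_verts)

text \<open>A vertex outside \<open>H1\<close> and \<open>H2\<close> lies on neither arc, so a spanning tour leaves no room for
  a third component.\<close>

lemma spanning_tour_iff:
  assumes comps: "H1 \<in> comps" "H2 \<in> comps" "H1 \<noteq> H2"
    and arcs: "comp_arc H1 p" "comp_arc H2 q"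
    and T: "anchors T = anchors p \<union> anchors q"
  shows "spanning H T \<longleftrightarrow> card comps = 2 \<and> verts H1 \<subseteq> anchors p \<and> verts H2 \<subseteq> anchors q"
proof
  assume span: "spanning H T"
  then have cover: "verts K \<subseteq> verts H1 \<union> verts H2" if "K \<in> comps" for K
    using that comp_arc_anchors[OF arcs(1)] comp_arc_anchors[OF arcs(2)] T
    by (auto simp: spanning_def verts_H)
  have "K \<in> {H1, H2}" if "K \<in> comps" for K
    using cover[OF that] component_verts_nonempty[OF that]
      components_disjoint[OF that comps(1)] components_disjoint[OF that comps(2)] by blast
  then have "comps = {H1, H2}"
    using comps by blast
  moreover have "verts H1 \<subseteq> anchors p" "verts H2 \<subseteq> anchors q"
    using span comps comp_arc_anchors[OF arcs(1)] comp_arc_anchors[OF arcs(2)]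
      components_disjoint[OF comps] T by (auto simp: spanning_def verts_H)
  ultimately show "card comps = 2 \<and> verts H1 \<subseteq> anchors p \<and> verts H2 \<subseteq> anchors q"
    using comps(3) by simp
next
  assume rhs: "card comps = 2 \<and> verts H1 \<subseteq> anchors p \<and> verts H2 \<subseteq> anchors q"
  then have "comps = {H1, H2}"
    using comps by (auto simp: card_2_iff)
  with rhs T show "spanning H T"
    by (auto simp: spanning_def verts_H)
qed

end

theorem theorem7p6p1:
  fixes H H1 H2 :: "('v, 'e) pre_hypergraph" and f1 f2 :: 'e
  assumes "hypergraph H"
    and "\<And>e. e \<in> edges H \<Longrightarrow> 2 \<le> card (ends H e)"
    and "f1 \<noteq> f2"
    and "minimal_edge_cut H {f1, f2}"
    and "H1 \<in> components (del_edges H {f1, f2})"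
    and "H2 \<in> components (del_edges H {f1, f2})"
    and "H1 \<noteq> H2"
    and "edges H1 \<noteq> {}"
    and "edges H2 \<noteq> {}"
    and "\<And>K. K \<in> components (del_edges H {f1, f2}) - {H1, H2} \<Longrightarrow> edges K = {}"
  shows "((\<exists>T. euler_tour H T) \<longleftrightarrow>
           (\<exists>T1. euler_tour (collapse_others H {f1, f2} H1) T1 \<and> None \<in> anchors T1) \<and>
           (\<exists>T2. euler_tour (collapse_others H {f1, f2} H2) T2 \<and> None \<in> anchors T2)) \<and>
         (\<forall>T. euler_tour H T \<longrightarrow>
           (\<exists>T1 T2. euler_tour (collapse_others H {f1, f2} H1) T1 \<and> None \<in> anchors T1 \<and>
                    euler_tour (collapse_others H {f1, f2} H2) T2 \<and> None \<in> anchors T2 \<and>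
                    (spanning H T \<longleftrightarrow> card (components (del_edges H {f1, f2})) = 2 \<and>
                       spanning (collapse_others H {f1, f2} H1) T1 \<and>
                       spanning (collapse_others H {f1, f2} H2) T2))) \<and>
         (\<forall>T1 T2. euler_tour (collapse_others H {f1, f2} H1) T1 \<and> None \<in> anchors T1 \<and>
                 euler_tour (collapse_others H {f1, f2} H2) T2 \<and> None \<in> anchors T2 \<longrightarrow>
           (\<exists>T. euler_tour H T \<and>
                    (spanning H T \<longleftrightarrow> card (components (del_edges H {f1, f2})) = 2 \<and>
                       spanning (collapse_others H {f1, f2} H1) T1 \<and>
                       spanning (collapse_others H {f1, f2} H2) T2))) \<and>
         ((\<exists>T. euler_tour H T \<and> spanning H T) \<longleftrightarrow>
           card (components (del_edges H {f1, f2})) = 2 \<and>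
           (\<exists>T1. euler_tour (collapse_others H {f1, f2} H1) T1 \<and>
                 spanning (collapse_others H {f1, f2} H1) T1) \<and>
           (\<exists>T2. euler_tour (collapse_others H {f1, f2} H2) T2 \<and>
                 spanning (collapse_others H {f1, f2} H2) T2))"
proof -
  interpret two_edge_cut H f1 f2
    using assms(1-4) by (simp add: two_edge_cut_def two_edge_cut_axioms_def)
  have swapped: "H2 \<noteq> H1"
    using assms(7) by simp
  let ?S1 = "collapse_others H {f1, f2} H1" and ?S2 = "collapse_others H {f1, f2} H2"
  let ?two = "card (components (del_edges H {f1, f2})) = 2"
  have split: "\<exists>T1 T2. euler_tour ?S1 T1 \<and> None \<in> anchors T1 \<and> euler_tour ?S2 T2 \<and>
      None \<in> anchors T2 \<and> (spanning H T \<longleftrightarrow> ?two \<and> spanning ?S1 T1 \<and> spanning ?S2 T2)"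
    if tour: "euler_tour H T" for T
  proof -
    obtain p q where arcs: "comp_arc H1 p" "comp_arc H2 q"
      and T: "anchors T = anchors p \<union> anchors q"
      using tour_imp_comp_arcs[OF assms(5-10) tour] by blast
    obtain T1 where T1: "euler_tour ?S1 T1" "anchors T1 = insert None (Some ` anchors p)"
      using comp_arc_imp_star_tour[OF assms(5-7) arcs(1)] by blast
    obtain T2 where T2: "euler_tour ?S2 T2" "anchors T2 = insert None (Some ` anchors q)"
      using comp_arc_imp_star_tour[OF assms(6,5) swapped arcs(2)] by blast
    have "spanning H T \<longleftrightarrow> ?two \<and> spanning ?S1 T1 \<and> spanning ?S2 T2"
      by (simp add: spanning_tour_iff[OF assms(5-7) arcs T] spanning_star_iff[OF assms(5) T1(2)]
          spanning_star_iff[OF assms(6) T2(2)])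
    with T1 T2 show ?thesis
      by blast
  qed
  have merge: "\<exists>T. euler_tour H T \<and>
      (spanning H T \<longleftrightarrow> ?two \<and> spanning ?S1 T1 \<and> spanning ?S2 T2)"
    if tours: "euler_tour ?S1 T1" "None \<in> anchors T1" "euler_tour ?S2 T2" "None \<in> anchors T2"
    for T1 T2
  proof -
    obtain p where p: "comp_arc H1 p" and T1: "anchors T1 = insert None (Some ` anchors p)"
      using star_tour_imp_comp_arc[OF assms(5-7) tours(1,2)] by blast
    obtain q where q: "comp_arc H2 q" and T2: "anchors T2 = insert None (Some ` anchors q)"
      using star_tour_imp_comp_arc[OF assms(6,5) swapped tours(3,4)] by blast
    obtain T where T: "euler_tour H T" "anchors T = anchors p \<union> anchors q"
      using comp_arcs_imp_tour[OF assms(5-7,10) p q] by blast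
    have "spanning H T \<longleftrightarrow> ?two \<and> spanning ?S1 T1 \<and> spanning ?S2 T2"
      by (simp add: spanning_tour_iff[OF assms(5-7) p q T(2)] spanning_star_iff[OF assms(5) T1]
          spanning_star_iff[OF assms(6) T2])
    with T(1) show ?thesis
      by blast
  qed
  have spanning_None: "None \<in> anchors T" if "spanning ?S1 T \<or> spanning ?S2 T" for T
    using that by (auto simp: spanning_def star_verts assms(5,6))
  show ?thesis
    using split merge spanning_None by meson
qed

end
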